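(* There is a deterministic algorithm which, given any integer $k>0$ and any $n$-bit string $F$, produces a summary $S_F$ of $\Theta(k\log^2\frac{n}{k})$ bits, together with a deterministic recovery algorithm which, given $S_F$ and any string $F'$ with $ED(F,F')\le k$, outputs $F$.
   Context: $ED(F,F')$ denotes the edit distance between strings $F$ and $F'$: the minimum number of single-symbol insertions, deletions, or substitutions transforming one into the other. Logarithms are base two.
   Formalization: The factor log(n/k) is replaced by max(1, log(n/k)), since k·log²(n/k) is 0 at k = n (where F cannot be recovered from 0 bits) and undefined at n = 0; for n ≥ 2k the bound is exactly as stated. *)

theory Defs
  imports Complex_Main
begin

inductive edit_step :: "'a list \<Rightarrow> 'a list \<Rightarrow> bool" where
  insertion: "edit_step (xs @ ys) (xs @ a # ys)"
| deletion: "edit_step (xs @ a # ys) (xs @ ys)"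
| substitution: "edit_step (xs @ a # ys) (xs @ b # ys)"

definition ED :: "'a list \<Rightarrow> 'a list \<Rightarrow> nat" where
  "ED F F' = (LEAST m. (edit_step ^^ m) F F')"

text \<open>The set in the definition of \<open>ED\<close> is never empty, so \<open>ED F F'\<close> is a genuine minimum.\<close>

lemma edit_step_to_Nil: "(edit_step ^^ length F) F []"
proof (induction F)
  case Nil
  show ?case by simp
next
  case (Cons a F)
  have "edit_step (a # F) F"
    using edit_step.deletion[of "[]" a F] by simp
  from relpowp_Suc_I2[OF this Cons.IH] show ?case
    by simp
qed

lemma edit_step_from_Nil: "(edit_step ^^ length F) [] F"
proof (induction F)
  case Nil
  show ?case by simp
next
  case (Cons a F)
  have "edit_step F (a # F)"
    using edit_step.insertion[of "[]" F a] by simp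
  with Cons.IH show ?case
    by auto
qed

lemma ED_attained: "(edit_step ^^ ED F F') F F'"
proof -
  have "(edit_step ^^ (length F + length F')) F F'"
    unfolding relpowp_add using edit_step_to_Nil edit_step_from_Nil by blast
  then show ?thesis
    unfolding ED_def by (rule LeastI)
qed

text \<open>
  Deterministic algorithms are modelled by Kleene's partial recursive functions:
  \<open>computes p xs y\<close> says that program \<open>p\<close> halts on input \<open>xs\<close> with output \<open>y\<close>.
  \<open>Mu f\<close> diverges if \<open>f\<close> diverges on a value below the first zero.
\<close>

datatype program =
    Zero
  | Succ
  | Proj nat
  | Comp program "program list"
  | PrimRec program program
  | Mu program

inductive computes :: "program \<Rightarrow> nat list \<Rightarrow> nat \<Rightarrow> bool" where
  Zero: "computes Zero xs 0"
| Succ: "computes Succ [x] (Suc x)"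
| Proj: "i < length xs \<Longrightarrow> computes (Proj i) xs (xs ! i)"
| Comp: "list_all2 (\<lambda>g y. computes g xs y) gs ys \<Longrightarrow> computes f ys z \<Longrightarrow>
    computes (Comp f gs) xs z"
| PrimRec_0: "computes f xs y \<Longrightarrow> computes (PrimRec f g) (0 # xs) y"
| PrimRec_Suc: "computes (PrimRec f g) (n # xs) r \<Longrightarrow> computes g (n # r # xs) y \<Longrightarrow>
    computes (PrimRec f g) (Suc n # xs) y"
| Mu: "computes f (n # xs) 0 \<Longrightarrow> (\<And>m. m < n \<Longrightarrow> \<exists>y. computes f (m # xs) (Suc y)) \<Longrightarrow>
    computes (Mu f) xs n"

lemma computes_deterministic:
  "computes p xs y \<Longrightarrow> computes p xs y' \<Longrightarrow> y = y'"
proof (induction arbitrary: y' rule: computes.induct)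
  case (Comp xs gs ys f z)
  from Comp.prems obtain ys' where
    *: "list_all2 (\<lambda>g y. computes g xs y) gs ys'" "computes f ys' y'"
    by (cases rule: computes.cases) auto
  have "ys = ys'"
    using Comp.IH(1) *(1) by (auto simp: list_all2_conv_all_nth intro!: nth_equalityI)
  with Comp.IH(2) *(2) show ?case by blast
next
  case (Mu f n xs)
  from Mu.prems have *: "computes f (y' # xs) 0"
    "\<And>m. m < y' \<Longrightarrow> \<exists>y. computes f (m # xs) (Suc y)"
    by (cases rule: computes.cases; blast)+
  show ?case
  proof (rule linorder_cases[of n y'])
    assume "n < y'"
    with *(2) Mu.IH(1) show ?thesis by blast
  next
    assume "y' < n"
    with *(1) Mu.IH(2) show ?thesis by blast
  qed
next
  case (PrimRec_0 f xs y g)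
  from PrimRec_0.prems have "computes f xs y'"
    by (cases rule: computes.cases) auto
  with PrimRec_0.IH show ?case by blast
next
  case (PrimRec_Suc f g n xs r y)
  from PrimRec_Suc.prems obtain r' where
    "computes (PrimRec f g) (n # xs) r'" "computes g (n # r' # xs) y'"
    by (cases rule: computes.cases) auto
  with PrimRec_Suc.IH show ?case by blast
qed (auto elim: computes.cases)

text \<open>Bijective base-2 numeration, least significant digit first.\<close>

fun code_bits :: "bool list \<Rightarrow> nat" where
  "code_bits [] = 0"
| "code_bits (b # bs) = 2 * code_bits bs + (if b then 2 else 1)"

lemma bij_code_bits: "bij code_bits"
proof (rule bijI)
  have "code_bits xs = code_bits ys \<Longrightarrow> xs = ys" for xs ys
  proof (induction xs arbitrary: ys)
    case Nil
    then show ?case by (cases ys) (auto split: if_splits)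
  next
    case (Cons a xs)
    then obtain b zs where ys: "ys = b # zs" by (cases ys) (auto split: if_splits)
    have "a = b \<and> code_bits xs = code_bits zs"
      using Cons.prems unfolding ys by (auto split: if_splits; presburger)
    with Cons.IH ys show ?case by blast
  qed
  then show "inj code_bits" by (rule injI)
  have "\<exists>xs. n = code_bits xs" for n
  proof (induction n rule: less_induct)
    case (less n)
    show ?case
    proof (cases "n = 0")
      case True
      then have "n = code_bits []" by simp
      then show ?thesis ..
    next
      case False
      then have "(n - 1) div 2 < n" by linarith
      then obtain xs where "(n - 1) div 2 = code_bits xs"
        using less.IH by blast
      with False have "n = code_bits (even n # xs)"
        by (cases "even n") (simp, presburger)+
      then show ?thesis ..
    qed
  qed
  then show "surj code_bits" by blast
qed

text \<open>
  The \<open>log\<^sup>2\<close> factor is read as at least 1, as is usual inside \<open>\<Theta>\<close>: \<open>k log\<^sup>2(n/k)\<close>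
  vanishes at \<open>k = n\<close>, where all \<open>n\<close>-bit strings need distinct summaries.
  For \<open>n \<ge> 2 k\<close> this is literally \<open>k log\<^sup>2(n/k)\<close>.
\<close>

definition size_bound :: "nat \<Rightarrow> nat \<Rightarrow> real" where
  "size_bound n k = real k * (max 1 (log 2 (real n / real k)))\<^sup>2"

end

theory Submission
  imports Defs
begin

text \<open>
  Nothing bounds the running time, so searching is allowed. The summary of \<open>F\<close> is
  \<open>(k, m, code F mod m)\<close>, where \<open>m\<close> is the least modulus that separates \<open>F\<close> from every other
  string reachable by at most \<open>4 k\<close> insertions and deletions. If \<open>ED F F' \<le> k\<close>, then \<open>F\<close> is
  reached from \<open>F'\<close> by at most \<open>2 k\<close> insertions and deletions, and any other candidate reached
  in this way with the same residue would be one of those strings; so a search around \<open>F'\<close>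
  finds \<open>F\<close>.

  With \<open>2 ^ l \<ge> n / k\<close> there are only \<open>N = 2 ^ O(k l)\<close> such strings. If no modulus up to \<open>M\<close>
  were separating, the product of the \<open>N\<close> differences of codes would be a common multiple of
  \<open>1, \<dots>, M\<close>, hence at least \<open>2 ^ (M - 1)\<close>, while it is at most \<open>2 ^ ((n + 4 k + 1) N)\<close>.
  Thus \<open>m\<close> has \<open>O(k l)\<close> bits, and all fields are padded to widths proportional to \<open>k l\<^sup>2\<close>.
\<close>

section \<open>Closure properties of computable functions\<close>

text \<open>
  The arguments are given as an environment \<open>e\<close>, of which only a finite prefix is read. A bound
  variable is the new entry \<open>e 0\<close>, so that the outer environment becomes \<open>\<lambda>i. e (Suc i)\<close>.
\<close>

definition computable :: "((nat \<Rightarrow> nat) \<Rightarrow> nat) \<Rightarrow> bool" where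
  "computable f \<longleftrightarrow> (\<exists>p a. \<forall>e. computes p (map e [0..<a]) (f e))"

definition decidable :: "((nat \<Rightarrow> nat) \<Rightarrow> bool) \<Rightarrow> bool" where
  "decidable P \<longleftrightarrow> computable (\<lambda>e. of_bool (P e))"

lemma computes_projections:
  assumes "a \<le> a'"
  shows "list_all2 (\<lambda>g y. computes g (map e [0..<a']) y) (map Proj [0..<a]) (map e [0..<a])"
  unfolding list_all2_conv_all_nth
proof (intro conjI allI impI)
  fix i assume "i < length (map Proj [0..<a])"
  then show "computes (map Proj [0..<a] ! i) (map e [0..<a']) (map e [0..<a] ! i)"
    using computes.Proj[of i "map e [0..<a']"] assms by simp
qed simp

text \<open>Composing with the first projections discards surplus arguments, so every larger arity
  works too.\<close>

lemma computable_arity: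
  assumes "computable f"
  obtains a where "\<And>a'. a \<le> a' \<Longrightarrow> \<exists>p. \<forall>e. computes p (map e [0..<a']) (f e)"
  using assms unfolding computable_def by (meson computes.Comp computes_projections)

lemma computable_common_arity:
  assumes "\<And>g. g \<in> set gs \<Longrightarrow> computable g"
  shows "\<exists>a. \<forall>a'\<ge>a. \<forall>g\<in>set gs. \<exists>p. \<forall>e. computes p (map e [0..<a']) (g e)"
  using assms
proof (induction gs)
  case (Cons g gs)
  from Cons obtain a where a: "\<forall>a'\<ge>a. \<forall>g\<in>set gs. \<exists>p. \<forall>e. computes p (map e [0..<a']) (g e)"
    by auto
  obtain a2 where a2: "\<And>a'. a2 \<le> a' \<Longrightarrow> \<exists>p. \<forall>e. computes p (map e [0..<a']) (g e)"
    using Cons.prems computable_arity[of g] by (metis list.set_intros(1))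
  show ?case
    by (rule exI[of _ "max a a2"]) (use a a2 in auto)
qed simp

text \<open>\<open>Comp\<close> runs its inner programs on one argument list, so all of
  \<open>gs\<close> are first brought to a common arity.\<close>

lemma computable_comp:
  assumes f: "\<And>e. computes p (map (\<lambda>g. g e) gs) (f e)"
    and gs: "\<And>g. g \<in> set gs \<Longrightarrow> computable g"
  shows "computable f"
proof -
  obtain a where "\<forall>g\<in>set gs. \<exists>p. \<forall>e. computes p (map e [0..<a]) (g e)"
    using computable_common_arity[of gs] gs by blast
  then obtain P where P: "\<And>g e. g \<in> set gs \<Longrightarrow> computes (P g) (map e [0..<a]) (g e)"
    by metis
  have "computes (Comp p (map P gs)) (map e [0..<a]) (f e)" for e
    by (rule computes.Comp[OF _ f[of e]]) (auto simp: list_all2_conv_all_nth P)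
  then show ?thesis
    unfolding computable_def by blast
qed

lemma computable_var: "computable (\<lambda>e. e i)"
  unfolding computable_def
proof (intro exI allI)
  fix e :: "nat \<Rightarrow> nat"
  show "computes (Proj i) (map e [0..<Suc i]) (e i)"
    using computes.Proj[of i "map e [0..<Suc i]"] by (simp del: upt_Suc)
qed

lemma computable_Suc: "computable f \<Longrightarrow> computable (\<lambda>e. Suc (f e))"
  by (rule computable_comp[where gs = "[f]" and p = Succ]) (auto intro: computes.Succ)

lemma computable_const: "computable (\<lambda>e. c)"
proof (induction c)
  case 0
  show ?case
    by (rule computable_comp[where gs = "[]" and p = Zero]) (auto intro: computes.Zero)
qed (rule computable_Suc)

text \<open>Although \<open>g\<close> is an infinite family, the program for \<open>f\<close> reads
  only \<open>a\<close> entries, so a finite composition suffices.\<close>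

lemma computable_subst:
  assumes "computable f" "\<And>i. computable (g i)"
  shows "computable (\<lambda>e. f (\<lambda>i. g i e))"
proof -
  obtain p a where p: "\<And>e. computes p (map e [0..<a]) (f e)"
    using assms(1) unfolding computable_def by blast
  show ?thesis
  proof (rule computable_comp)
    fix e :: "nat \<Rightarrow> nat"
    show "computes p (map (\<lambda>h. h e) (map g [0..<a])) (f (\<lambda>i. g i e))"
      using p[of "\<lambda>i. g i e"] by (simp add: comp_def)
  qed (use assms(2) in auto)
qed

lemma computable_subst3:
  assumes "computable (\<lambda>e. f (e 0) (e 1) (e 2))" "computable x" "computable y" "computable z"
  shows "computable (\<lambda>e. f (x e) (y e) (z e))"
  using computable_subst[OF assms(1),
      of "\<lambda>i. if i = 0 then x else if i = 1 then y else if i = 2 then z else (\<lambda>e. 0)"]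
    assms(2-) by (simp add: computable_const)

lemma computable_subst2:
  assumes "computable (\<lambda>e. f (e 0) (e 1))" "computable x" "computable y"
  shows "computable (\<lambda>e. f (x e) (y e))"
  using computable_subst3[where f = "\<lambda>x y z. f x y"] assms by blast

lemma computable_subst1:
  assumes "computable (\<lambda>e. f (e 0))" "computable x"
  shows "computable (\<lambda>e. f (x e))"
  using computable_subst2[where f = "\<lambda>x y. f x"] assms by blast

lemma map_case_nat_upt: "map (case_nat x e) [0..<Suc a] = x # map e [0..<a]"
  by (simp add: map_upt_Suc del: upt_Suc)

text \<open>Counter and accumulator become entries 0 and 1 of the environment, in the order in which
  \<open>PrimRec\<close> passes them to its step program.\<close>

lemma computable_rec_nat:
  assumes "computable f" "computable (\<lambda>e. g (e 0) (e (Suc 0)) (\<lambda>i. e (Suc (Suc i))))" "computable n"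
  shows "computable (\<lambda>e. rec_nat (f e) (\<lambda>i r. g i r e) (n e))"
proof -
  obtain a1 where a1: "\<And>a. a1 \<le> a \<Longrightarrow> \<exists>p. \<forall>e. computes p (map e [0..<a]) (f e)"
    using computable_arity[OF assms(1)] by blast
  obtain a2 where a2: "\<And>a. a2 \<le> a \<Longrightarrow> \<exists>p. \<forall>e. computes p (map e [0..<a])
      (g (e 0) (e (Suc 0)) (\<lambda>i. e (Suc (Suc i))))"
    using computable_arity[OF assms(2)] by blast
  define a where "a = max a1 a2"
  obtain p where p: "\<And>e. computes p (map e [0..<a]) (f e)"
    using a1[of a] unfolding a_def by auto
  obtain q where q: "\<And>e. computes q (map e [0..<Suc (Suc a)])
      (g (e 0) (e (Suc 0)) (\<lambda>i. e (Suc (Suc i))))"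
    using a2[of "Suc (Suc a)"] unfolding a_def by force
  have step: "computes q (i # r # map e [0..<a]) (g i r e)" for i r e
    using q[of "case_nat i (case_nat r e)"] unfolding map_case_nat_upt by simp
  have rec: "computes (PrimRec p q) (k # map e [0..<a]) (rec_nat (f e) (\<lambda>i r. g i r e) k)" for k e
    by (induction k) (auto intro: computes.PrimRec_0 computes.PrimRec_Suc p step)
  show ?thesis
  proof (rule computable_comp)
    fix e :: "nat \<Rightarrow> nat"
    show "computes (PrimRec p q) (map (\<lambda>h. h e) (n # map (\<lambda>i e. e i) [0..<a]))
        (rec_nat (f e) (\<lambda>i r. g i r e) (n e))"
      using rec[of "n e" e] by (simp add: comp_def)
    show "computable h" if "h \<in> set (n # map (\<lambda>i e. e i) [0..<a])" for h
      using that assms(3) by (auto simp: computable_var)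
  qed
qed

section \<open>Arithmetic operations and bounded sums\<close>

lemma computable_add: "computable f \<Longrightarrow> computable g \<Longrightarrow> computable (\<lambda>e. f e + g e)"
proof (rule computable_subst2[where f = "(+)"])
  have "rec_nat x (\<lambda>i r. Suc r) y = x + y" for x y :: nat
    by (induction y) auto
  then show "computable (\<lambda>e. e 0 + e 1)"
    using computable_rec_nat[where f = "\<lambda>e. e 0" and g = "\<lambda>i r e. Suc r" and n = "\<lambda>e. e 1"]
    by (simp add: computable_var computable_Suc)
qed

lemma computable_mult: "computable f \<Longrightarrow> computable g \<Longrightarrow> computable (\<lambda>e. f e * g e)"
proof (rule computable_subst2[where f = "(*)"])
  have "rec_nat 0 (\<lambda>i r. r + x) y = x * y" for x y :: nat
    by (induction y) auto
  then show "computable (\<lambda>e. e 0 * e 1)"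
    using computable_rec_nat[where f = "\<lambda>e. 0" and g = "\<lambda>i r e. r + e 0" and n = "\<lambda>e. e 1"]
    by (simp add: computable_var computable_add computable_const)
qed

lemma computable_power: "computable f \<Longrightarrow> computable g \<Longrightarrow> computable (\<lambda>e. f e ^ g e)"
proof (rule computable_subst2[where f = "(^)"])
  have "rec_nat 1 (\<lambda>i r. r * x) y = x ^ y" for x y :: nat
    by (induction y) auto
  then show "computable (\<lambda>e. e 0 ^ e 1)"
    using computable_rec_nat[where f = "\<lambda>e. 1" and g = "\<lambda>i r e. r * e 0" and n = "\<lambda>e. e 1"]
    by (simp add: computable_var computable_mult computable_const)
qed

lemma computable_diff: "computable f \<Longrightarrow> computable g \<Longrightarrow> computable (\<lambda>e. f e - g e)"
proof (rule computable_subst2[where f = "(-)"])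
  \<comment> \<open>Predecessor: the recursion returns its counter and ignores the previous
    value.\<close>
  have pred: "rec_nat 0 (\<lambda>i r. i) y = y - 1" for y :: nat
    by (cases y) auto
  have "computable (\<lambda>e. e 0 - 1)"
    using computable_rec_nat[where f = "\<lambda>e. 0" and g = "\<lambda>i r e. i" and n = "\<lambda>e. e 0"]
    unfolding pred by (simp add: computable_var computable_const)
  from computable_subst1[OF this computable_var] have pred': "computable (\<lambda>e. e i - 1)" for i .
  have "rec_nat x (\<lambda>i r. r - 1) y = x - y" for x y :: nat
    by (induction y) auto
  then show "computable (\<lambda>e. e 0 - e 1)"
    using computable_rec_nat[where f = "\<lambda>e. e 0" and g = "\<lambda>i r e. r - 1" and n = "\<lambda>e. e 1"]
      pred' by (simp add: computable_var computable_const)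
qed

lemma computable_sum:
  assumes "computable (\<lambda>e. g (e 0) (\<lambda>i. e (Suc i)))" "computable n"
  shows "computable (\<lambda>e. \<Sum>i<n e. g i e)"
proof -
  have "rec_nat 0 (\<lambda>i r. r + g i e) k = (\<Sum>i<k. g i e)" for e k
    by (induction k) auto
  \<comment> \<open>The substitution skips entry 1, which holds the accumulator.\<close>
  moreover have "computable (\<lambda>e. g (e 0) (\<lambda>i. e (Suc (Suc i))))"
    using computable_subst[OF assms(1), of "\<lambda>i e. e (if i = 0 then 0 else Suc i)"]
    by (simp add: computable_var)
  ultimately show ?thesis
    using computable_rec_nat[where f = "\<lambda>e. 0" and g = "\<lambda>i r e. r + g i e" and n = n] assms(2)
    by (simp add: computable_var computable_add computable_const)
qed

section \<open>Decidable predicates, bounded quantifiers and unbounded search\<close>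

lemma decidable_not: "decidable P \<Longrightarrow> decidable (\<lambda>e. \<not> P e)"
  unfolding decidable_def
proof -
  assume "computable (\<lambda>e. of_bool (P e))"
  then have "computable (\<lambda>e. 1 - of_bool (P e))"
    by (intro computable_diff computable_const)
  moreover have "1 - of_bool Q = (of_bool (\<not> Q) :: nat)" for Q
    by simp
  ultimately show "computable (\<lambda>e. of_bool (\<not> P e))"
    by (simp only:)
qed

lemma decidable_conj: "decidable P \<Longrightarrow> decidable Q \<Longrightarrow> decidable (\<lambda>e. P e \<and> Q e)"
  unfolding decidable_def of_bool_conj by (rule computable_mult)

lemma decidable_disj: "decidable P \<Longrightarrow> decidable Q \<Longrightarrow> decidable (\<lambda>e. P e \<or> Q e)"
  using decidable_not[OF decidable_conj[OF decidable_not decidable_not], of P Q] by simp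

lemma decidable_imp: "decidable P \<Longrightarrow> decidable Q \<Longrightarrow> decidable (\<lambda>e. P e \<longrightarrow> Q e)"
  unfolding imp_conv_disj by (intro decidable_disj decidable_not)

lemma decidable_eq_0: "computable f \<Longrightarrow> decidable (\<lambda>e. f e = 0)"
proof -
  assume "computable f"
  then have "computable (\<lambda>e. 1 - f e)"
    by (intro computable_diff computable_const)
  moreover have "of_bool (x = 0) = 1 - x" for x :: nat
    by simp
  ultimately show ?thesis
    unfolding decidable_def by simp
qed

lemma decidable_le: "computable f \<Longrightarrow> computable g \<Longrightarrow> decidable (\<lambda>e. f e \<le> g e)"
  using decidable_eq_0[OF computable_diff, of f g] by simp

lemma decidable_less: "computable f \<Longrightarrow> computable g \<Longrightarrow> decidable (\<lambda>e. f e < g e)"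
  using decidable_le[OF computable_Suc, of f g] by (simp add: Suc_le_eq)

lemma decidable_eq: "computable f \<Longrightarrow> computable g \<Longrightarrow> decidable (\<lambda>e. f e = g e)"
  unfolding order_eq_iff by (intro decidable_conj decidable_le)

text \<open>A sum of truth values is positive exactly when some witness occurs.\<close>

lemma decidable_ex_less:
  assumes "computable n" "decidable (\<lambda>e. P (e 0) (\<lambda>i. e (Suc i)))"
  shows "decidable (\<lambda>e. \<exists>i<n e. P i e)"
proof -
  have "decidable (\<lambda>e. 0 < (\<Sum>i<n e. of_bool (P i e) :: nat))"
    using assms unfolding decidable_def[of "\<lambda>e. P (e 0) (\<lambda>i. e (Suc i))"]
    by (intro decidable_less computable_const computable_sum)
  moreover have "0 < (\<Sum>i<n e. of_bool (P i e) :: nat) \<longleftrightarrow> (\<exists>i<n e. P i e)" for e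
    by (auto simp: sum_eq_0_iff simp flip: neq0_conv)
  ultimately show ?thesis by simp
qed

lemma decidable_ex_le:
  assumes "computable n" "decidable (\<lambda>e. P (e 0) (\<lambda>i. e (Suc i)))"
  shows "decidable (\<lambda>e. \<exists>i\<le>n e. P i e)"
  using decidable_ex_less[OF computable_Suc, of n P] assms by (simp add: less_Suc_eq_le)

lemma decidable_all_less:
  assumes "computable n" "decidable (\<lambda>e. P (e 0) (\<lambda>i. e (Suc i)))"
  shows "decidable (\<lambda>e. \<forall>i<n e. P i e)"
  using decidable_not[OF decidable_ex_less[of n "\<lambda>i e. \<not> P i e"]] assms
  by (simp add: decidable_not)

lemma computable_of_bool: "decidable P \<Longrightarrow> computable (\<lambda>e. of_bool (P e))"
  by (simp add: decidable_def)

text \<open>\<open>Mu\<close> looks for a zero, so its program evaluates the negation of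
  \<open>P\<close>; the assumption \<open>ex\<close> makes the search halt in every
  environment.\<close>

lemma computable_Least:
  assumes "decidable (\<lambda>e. P (e 0) (\<lambda>i. e (Suc i)))" and ex: "\<And>e. \<exists>i. P i e"
  shows "computable (\<lambda>e. LEAST i. P i e)"
proof -
  obtain a where a: "\<And>a'. a \<le> a' \<Longrightarrow> \<exists>p. \<forall>e. computes p (map e [0..<a'])
      (of_bool (\<not> P (e 0) (\<lambda>i. e (Suc i))))"
    using decidable_not[OF assms(1)] computable_arity unfolding decidable_def by blast
  then obtain p where p: "\<And>e. computes p (map e [0..<Suc a]) (of_bool (\<not> P (e 0) (\<lambda>i. e (Suc i))))"
    using a[of "Suc a"] by auto
  have p': "computes p (i # map e [0..<a]) (of_bool (\<not> P i e))" for i e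
    using p[of "case_nat i e"] unfolding map_case_nat_upt by simp
  have "computes (Mu p) (map e [0..<a]) (LEAST i. P i e)" for e
  proof (rule computes.Mu)
    show "computes p ((LEAST i. P i e) # map e [0..<a]) 0"
      using p'[of "LEAST i. P i e" e] LeastI_ex[OF ex, of e] by simp
    show "\<exists>y. computes p (m # map e [0..<a]) (Suc y)" if "m < (LEAST i. P i e)" for m
      using p'[of m e] not_less_Least[OF that] by auto
  qed
  then show ?thesis
    unfolding computable_def by blast
qed

lemma computable_div: "computable f \<Longrightarrow> computable g \<Longrightarrow> computable (\<lambda>e. f e div g e)"
proof (rule computable_subst2[where f = "(div)"])
  \<comment> \<open>The quotient is the first \<open>q\<close> with \<open>x < y * Suc q\<close>;
    for \<open>y = 0\<close> the search stops at 0, which is the value of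
    \<open>x div 0\<close>.\<close>
  have *: "x div y = (LEAST q. y = 0 \<or> x < y * Suc q)" for x y :: nat
  proof (cases "y = 0")
    case False
    show ?thesis
      by (rule Least_equality[symmetric])
        (use False in \<open>auto simp: dividend_less_times_div less_mult_imp_div_less mult.commute
           simp flip: less_Suc_eq_le\<close>)
  qed simp
  show "computable (\<lambda>e. e 0 div e 1)"
    unfolding *
  proof (intro computable_Least decidable_disj decidable_eq decidable_less computable_var
      computable_const computable_mult computable_Suc)
    show "\<exists>q. e 1 = 0 \<or> e 0 < e 1 * Suc q" for e :: "nat \<Rightarrow> nat"
      by (rule exI[of _ "e 0"]) (cases "e 1", auto)
  qed
qed

lemma computable_mod: "computable f \<Longrightarrow> computable g \<Longrightarrow> computable (\<lambda>e. f e mod g e)"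
  unfolding modulo_nat_def by (intro computable_diff computable_mult computable_div)

lemma decidable_subst2:
  assumes "decidable (\<lambda>e. P (e 0) (e 1))" "computable x" "computable y"
  shows "decidable (\<lambda>e. P (x e) (y e))"
  using computable_subst2[where f = "\<lambda>x y. of_bool (P x y)"] assms unfolding decidable_def by blast

lemmas computable_intros =
  computable_var computable_const computable_Suc computable_add computable_mult computable_power
  computable_diff computable_div computable_mod computable_sum
  decidable_not decidable_conj decidable_disj decidable_imp decidable_le decidable_less
  decidable_eq decidable_ex_less decidable_ex_le decidable_all_less

lemma computes_binary:
  assumes "computable (\<lambda>e. f (e 0) (e 1))"
  obtains p where "\<And>x y. computes p [x, y] (f x y)"
proof -
  obtain a p where p: "\<And>e. computes p (map e [0..<a]) (f (e 0) (e 1))"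
    using assms unfolding computable_def by blast
  \<comment> \<open>The program \<open>p\<close> may read more than two entries; the others are
    filled with 0.\<close>
  define q where "q i = (if i < 2 then Proj i else Zero)" for i
  have "computes (Comp p (map q [0..<a])) [x, y] (f x y)" for x y
  proof (rule computes.Comp)
    define e where "e i = (if i < 2 then [x, y] ! i else 0)" for i
    show "computes p (map e [0..<a]) (f x y)"
      using p[of e] by (simp add: e_def)
    show "list_all2 (\<lambda>g y'. computes g [x, y] y') (map q [0..<a]) (map e [0..<a])"
      using computes.Proj[of _ "[x, y]"]
      by (auto simp: list_all2_conv_all_nth q_def e_def intro: computes.Zero)
  qed
  then show ?thesis using that by blast
qed

section \<open>Small moduli\<close>

text \<open>The numbers \<open>1 / (Suc n * (n choose j))\<close> form Leibniz's harmonic triangle, in which every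
  entry is the entry diagonally above it minus its left neighbour.\<close>

lemma Ints_divide_binomial:
  assumes "\<And>i. 1 \<le> i \<Longrightarrow> i \<le> Suc n \<Longrightarrow> i dvd D" and "j \<le> n"
  shows "real D / (real (Suc n) * real (n choose j)) \<in> \<int>"
  using assms
proof (induction j arbitrary: n)
  case 0
  then have "Suc n dvd D" by simp
  then obtain d where "D = Suc n * d" by (rule dvdE)
  then have "real D / (real (Suc n) * real (n choose 0)) = of_int (int d)"
    by (simp add: field_simps)
  then show ?case by (metis Ints_of_int)
next
  case (Suc j n')
  then obtain n where n: "n' = Suc n" by (cases n') auto
  let ?x = "real D / (real (Suc n) * real (n choose j))"
  let ?y = "real D / (real (Suc (Suc n)) * real (Suc n choose j))"
  have jn: "j \<le> n" using Suc.prems n by simp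
  have "Suc j * (Suc n choose Suc j) = Suc n * (n choose j)"
    by (rule Suc_times_binomial)
  then have e1: "real (Suc j) * real (Suc n choose Suc j) = real (Suc n) * real (n choose j)"
    by (metis of_nat_mult)
  have "(Suc n - j) * (Suc n choose j) = Suc n * (n choose j)"
    using binomial_absorb_comp[of "Suc n" j] by simp
  then have e2: "(real (Suc n) - real j) * real (Suc n choose j) = real (Suc n) * real (n choose j)"
    using jn by (metis of_nat_mult of_nat_diff le_SucI)
  \<comment> \<open>Both binomials of the next row are quotients of \<open>c\<close>, which reduces
    the triangle rule to an identity of fractions with \<open>N = n + 2\<close> and
    \<open>a = j + 1\<close>.\<close>
  define c where "c = real (Suc n) * real (n choose j)"
  have c: "c > 0" using jn by (simp add: c_def)
  have p1: "real (Suc n choose Suc j) = c / real (Suc j)"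
    using e1 by (simp add: c_def field_simps)
  have p2: "real (Suc n choose j) = c / (real (Suc n) - real j)"
    using e2 jn by (simp add: c_def field_simps)
  have "real D / (real (Suc (Suc n)) * real (Suc n choose Suc j)) = ?x - ?y"
  proof -
    have "x / (N * (c / a)) = x / c - x / (N * (c / (N - a)))" if "N > 0" for x N a :: real
      using that c by (simp add: field_simps)
    from this[of "real (Suc (Suc n))" "real D" "real (Suc j)"] show ?thesis
      unfolding p1 p2 c_def[symmetric] by simp
  qed
  moreover have "?x \<in> \<int>"
    using Suc.IH[of n] Suc.prems jn n by simp
  moreover have "?y \<in> \<int>"
    using Suc.IH[of "Suc n"] Suc.prems jn n by simp
  ultimately show ?case
    unfolding n by simp
qed

text \<open>Each quotient of the harmonic triangle is a positive integer, so
  \<open>Suc n * (n choose j) \<le> D\<close>; summing over the row \<open>j \<le> n\<close> gives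
  \<open>Suc n * 2 ^ n \<le> Suc n * D\<close>.\<close>

lemma two_power_le_common_multiple:
  fixes D :: nat
  assumes "\<And>i. 1 \<le> i \<Longrightarrow> i \<le> Suc n \<Longrightarrow> i dvd D" and "D > 0"
  shows "2 ^ n \<le> D"
proof -
  have le: "Suc n * (n choose j) \<le> D" if "j \<le> n" for j
  proof -
    have pos: "0 < real (Suc n) * real (n choose j)" using that by simp
    have "real D / (real (Suc n) * real (n choose j)) \<in> \<int>"
      using assms(1) that by (rule Ints_divide_binomial)
    then obtain z where z: "real D / (real (Suc n) * real (n choose j)) = of_int z"
      by (rule Ints_cases)
    have "0 < real D / (real (Suc n) * real (n choose j))"
      using pos assms(2) by (intro divide_pos_pos) auto
    then have "1 \<le> real D / (real (Suc n) * real (n choose j))" unfolding z by simp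
    then have "real (Suc n * (n choose j)) \<le> real D"
      using pos by (simp add: field_simps)
    then show ?thesis by (simp only: of_nat_le_iff)
  qed
  have "Suc n * 2 ^ n = (\<Sum>j\<le>n. Suc n * (n choose j))"
    by (simp only: sum_distrib_left[symmetric] choose_row_sum)
  also have "\<dots> \<le> (\<Sum>j\<le>n. D)"
    by (intro sum_mono le) simp
  also have "\<dots> = Suc n * D" by simp
  finally show ?thesis by (simp only: Suc_mult_le_cancel1)
qed

text \<open>Otherwise \<open>\<Prod>A\<close> is a common multiple of all numbers up to
  \<open>w * card A + 2\<close>. The summand 2 makes the resulting lower bound
  \<open>2 ^ Suc (w * card A)\<close> exceed the upper bound
  \<open>2 ^ (w * card A)\<close>.\<close>

lemma small_nondivisor:
  fixes A :: "nat set"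
  assumes "finite A" and "\<And>d. d \<in> A \<Longrightarrow> 0 < d \<and> d \<le> 2 ^ w"
  obtains m where "0 < m" "m \<le> w * card A + 2" "\<And>d. d \<in> A \<Longrightarrow> \<not> m dvd d"
proof -
  have "\<exists>m. 0 < m \<and> m \<le> w * card A + 2 \<and> (\<forall>d\<in>A. \<not> m dvd d)"
  proof (rule ccontr)
    assume no: "\<not> ?thesis"
    have "m dvd \<Prod>A" if "1 \<le> m" "m \<le> Suc (Suc (w * card A))" for m
    proof -
      have "\<exists>d\<in>A. m dvd d" using no that by auto
      then show ?thesis using assms(1) dvd_prodI[of A _ "\<lambda>x. x"] dvd_trans by blast
    qed
    moreover have "0 < \<Prod>A" using assms by (intro prod_pos) auto
    ultimately have "2 ^ Suc (w * card A) \<le> \<Prod>A"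
      by (rule two_power_le_common_multiple)
    also have "\<Prod>A \<le> (2 ^ w) ^ card A"
      using prod_mono[of A "\<lambda>x. x" "\<lambda>_. 2 ^ w"] assms by auto
    also have "\<dots> = 2 ^ (w * card A)"
      by (simp add: power_mult)
    finally show False by simp
  qed
  then show ?thesis using that by blast
qed

section \<open>Counting strings at bounded insertion-deletion distance\<close>

text \<open>An alignment read from left to right, so that counting can split on the first symbol.
  \<open>Nil\<close> accepts leftover budget, hence \<open>j\<close> is an upper bound on the
  edits.\<close>

inductive indel :: "nat \<Rightarrow> 'a list \<Rightarrow> 'a list \<Rightarrow> bool" where
  Nil: "indel j [] []"
| Keep: "indel j F G \<Longrightarrow> indel j (a # F) (a # G)"
| Delete: "indel j F G \<Longrightarrow> indel (Suc j) (a # F) G"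
| Insert: "indel j F G \<Longrightarrow> indel (Suc j) F (a # G)"

lemma indel_refl: "indel j F F"
  by (induction F) (auto intro: indel.intros)

lemma indel_Suc: "indel j F G \<Longrightarrow> indel (Suc j) F G"
  by (induction rule: indel.induct) (auto intro: indel.intros)

text \<open>The new edit is pushed along the alignment to its position, so edits performed in any
  order can be sorted from left to right.\<close>

lemma indel_insertion: "indel j F (xs @ ys) \<Longrightarrow> indel (Suc j) F (xs @ a # ys)"
proof (induction j F "xs @ ys" arbitrary: xs rule: indel.induct)
  case (Nil j)
  then show ?case by (auto intro: indel.intros)
next
  case (Keep j F G b)
  then show ?case
    by (cases xs) (auto intro: indel.intros)
next
  case (Delete j F b)
  then show ?case by (auto intro: indel.intros)
next
  case (Insert j F G b)
  then show ?case
    by (cases xs) (auto intro: indel.intros)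
qed

text \<open>Removing a kept symbol turns \<open>Keep\<close> into \<open>Delete\<close>; removing an
  inserted one cancels its insertion and leaves spare budget.\<close>

lemma indel_deletion: "indel j F (xs @ a # ys) \<Longrightarrow> indel (Suc j) F (xs @ ys)"
proof (induction j F "xs @ a # ys" arbitrary: xs rule: indel.induct)
  case (Keep j F G b)
  then show ?case
    by (cases xs) (auto intro: indel.intros)
next
  case (Delete j F b)
  then show ?case by (auto intro: indel.intros)
next
  case (Insert j F G b)
  then show ?case
    by (cases xs) (auto intro: indel.intros indel_Suc)
qed simp

lemma indel_length: "indel j F G \<Longrightarrow> length G \<le> length F + j"
  by (induction rule: indel.induct) auto

lemma finite_indel: "finite {G :: bool list. indel j F G}"
proof (rule finite_subset)
  show "{G. indel j F G} \<subseteq> {G. set G \<subseteq> UNIV \<and> length G \<le> length F + j}"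
    using indel_length by auto
  show "finite {G. set G \<subseteq> (UNIV :: bool set) \<and> length G \<le> length F + j}"
    by (rule finite_lists_length_le) simp
qed

abbreviation indel_ball :: "nat \<Rightarrow> bool list \<Rightarrow> bool list set" where
  "indel_ball j F \<equiv> {G. indel j F G}"

lemma card_Un3_le: "card (A \<union> B \<union> C) \<le> card A + card B + card C"
  by (meson add_le_mono1 card_Un_le order_trans)

text \<open>The weight \<open>X ^ j\<close> penalises each edit; it turns the recursion along \<open>F\<close> for the
  cardinalities into a one-line estimate, valid because \<open>1 / X + 2 (1 + 5 / X) / X \<le> 5 / X\<close>.\<close>

lemma card_indel_ball:
  fixes X :: real
  assumes "X \<ge> 16"
  shows "real (card (indel_ball j F)) \<le> X ^ j * (1 + 5 / X) ^ length F"
\<comment> \<open>Insertions lower \<open>j\<close> and leave \<open>F\<close> unchanged, while the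
  other cases shorten \<open>F\<close>; the sum decreases in all of them.\<close>
proof (induction "j + length F" arbitrary: j F rule: less_induct)
  case less
  have X: "0 < X" "5 / X \<le> 1" using assms by auto
  have pos: "0 \<le> 1 + 5 / X" using X by simp
  \<comment> \<open>Results that begin with an inserted symbol: two bits and one unit of budget
    account for the factor \<open>2 / X\<close>.\<close>
  define ins where "ins = (if j = 0 then {} else
    Cons True ` indel_ball (j - 1) F \<union> Cons False ` indel_ball (j - 1) F)"
  have ins: "real (card ins) \<le> 2 / X * (X ^ j * (1 + 5 / X) ^ length F)"
  proof (cases j)
    case (Suc i)
    have "card ins \<le> 2 * card (indel_ball i F)"
      unfolding ins_def Suc using card_Un_le[of "Cons True ` indel_ball i F" "Cons False ` indel_ball i F"]
        card_image_le[OF finite_indel, of "Cons True" i F] card_image_le[OF finite_indel, of "Cons False" i F]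
      by simp
    then have "real (card ins) \<le> 2 * real (card (indel_ball i F))"
      by linarith
    also have "\<dots> \<le> 2 * (X ^ i * (1 + 5 / X) ^ length F)"
      using less[of i F] Suc by simp
    finally show ?thesis using X Suc by simp
  qed (use X pos in \<open>simp add: ins_def\<close>)
  show ?case
  proof (cases F)
    case Nil
    have "indel_ball j F \<subseteq> {[]} \<union> ins"
    proof
      fix G assume "G \<in> indel_ball j F"
      then have "indel j [] G" using Nil by simp
      then show "G \<in> {[]} \<union> ins"
      proof cases
        case (Insert i G' b)
        then show ?thesis using Nil by (cases b) (auto simp: ins_def)
      qed auto
    qed
    then have "card (indel_ball j F) \<le> card ({[]} \<union> ins)"
      by (intro card_mono) (auto simp: ins_def finite_indel)
    also have "\<dots> \<le> 1 + card ins" using card_Un_le[of "{[]}" ins] by simp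
    finally have le: "real (card (indel_ball j F)) \<le> 1 + real (card ins)" by linarith
    show ?thesis
    proof (cases j)
      case 0
      then show ?thesis using le Nil by (simp add: ins_def)
    next
      case (Suc i)
      have "1 \<le> X ^ i" using assms by (intro one_le_power) simp
      moreover have "real (card ins) \<le> 2 * X ^ i"
        using ins X unfolding Nil Suc by simp
      moreover have "16 * X ^ i \<le> X * X ^ i"
        using assms X by (intro mult_right_mono) auto
      ultimately have "real (card (indel_ball j F)) \<le> X * X ^ i" using le by linarith
      then show ?thesis unfolding Nil Suc by simp
    qed
  next
    case (Cons a F')
    define W where "W = X ^ j * (1 + 5 / X) ^ length F'"
    have W: "0 \<le> W" using X by (simp add: W_def)
    define del where "del = (if j = 0 then {} else indel_ball (j - 1) F')"
    have del: "real (card del) \<le> W / X"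
    proof (cases j)
      case (Suc i)
      have "real (card del) \<le> X ^ i * (1 + 5 / X) ^ length F'"
        using less[of i F'] Suc Cons by (simp add: del_def)
      then show ?thesis using X Suc by (simp add: W_def)
    qed (use X W in \<open>simp add: del_def\<close>)
    have keep: "real (card (Cons a ` indel_ball j F')) \<le> W"
      using less[of j F'] card_image_le[OF finite_indel, of "Cons a" j F'] Cons unfolding W_def
      by simp
    have "indel_ball j F \<subseteq> Cons a ` indel_ball j F' \<union> del \<union> ins"
    proof
      fix G assume "G \<in> indel_ball j F"
      then have "indel j (a # F') G" using Cons by simp
      then show "G \<in> Cons a ` indel_ball j F' \<union> del \<union> ins"
      proof cases
        case (Insert i G' b)
        then show ?thesis using Cons by (cases b) (auto simp: ins_def)
      qed (auto simp: del_def)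
    qed
    then have "card (indel_ball j F) \<le> card (Cons a ` indel_ball j F' \<union> del \<union> ins)"
      by (intro card_mono) (auto simp: ins_def del_def finite_indel)
    also have "\<dots> \<le> card (Cons a ` indel_ball j F') + card del + card ins"
      by (rule card_Un3_le)
    finally have "real (card (indel_ball j F)) \<le> W + W / X + 2 / X * (W * (1 + 5 / X))"
      using keep del ins Cons by (simp add: W_def mult_ac)
    \<comment> \<open>Bounding \<open>1 + 5 / X\<close> by 2 leaves 4 units of \<open>W / X\<close>
      for insertions, beside 1 for deletion: this is where the constant 5 comes from.\<close>
    also have "2 / X * (W * (1 + 5 / X)) \<le> 2 / X * (W * 2)"
      using X W by (intro mult_left_mono) auto
    also have "W + W / X + 2 / X * (W * 2) = W * (1 + 5 / X)"
      using X by (simp add: field_simps)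
    finally show ?thesis unfolding Cons W_def by (simp add: mult_ac)
  qed
qed

section \<open>Insertions and deletions on codes\<close>

lemma code_bits_append: "code_bits (xs @ ys) = code_bits xs + 2 ^ length xs * code_bits ys"
  by (induction xs) (auto simp: algebra_simps)

text \<open>In binary, \<open>Suc (code_bits F)\<close> consists of the bits of \<open>F\<close>
  below a leading 1, so the code determines the length by its magnitude.\<close>

lemma code_bits_bounds: "2 ^ length F \<le> Suc (code_bits F) \<and> Suc (code_bits F) < 2 * 2 ^ length F"
  by (induction F) auto

lemma length_unique:
  assumes "2 ^ p \<le> Suc x" "Suc x < 2 * 2 ^ p" "2 ^ q \<le> Suc x" "Suc x < 2 * 2 ^ q"
  shows "p = (q :: nat)"
proof -
  have "(2 :: nat) ^ p < 2 ^ Suc q" "(2 :: nat) ^ q < 2 ^ Suc p" using assms by auto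
  then show ?thesis
    using power_less_imp_less_exp[of "2 :: nat" p "Suc q"] power_less_imp_less_exp[of "2 :: nat" q "Suc p"] by auto
qed

text \<open>Here \<open>p\<close>, \<open>x\<close> and \<open>y\<close> are the length and the code of the part before the inserted symbol
  and the code of the part after it.\<close>

definition ins_code :: "nat \<Rightarrow> nat \<Rightarrow> bool" where
  "ins_code u v \<longleftrightarrow> (\<exists>p\<le>u. \<exists>x\<le>u. \<exists>y\<le>u. 2 ^ p \<le> Suc x \<and> Suc x < 2 * 2 ^ p \<and> u = x + 2 ^ p * y \<and>
     (v = x + 2 ^ p * (2 * y + 1) \<or> v = x + 2 ^ p * (2 * y + 2)))"

text \<open>Equality is included so that the \<open>j\<close>-th iterate means at most
  \<open>j\<close> edits.\<close>

definition near :: "nat \<Rightarrow> nat \<Rightarrow> bool" where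
  "near u v \<longleftrightarrow> u = v \<or> ins_code u v \<or> ins_code v u"

lemma ins_code_code_bits:
  "ins_code (code_bits G) (code_bits H) \<longleftrightarrow> (\<exists>xs ys a. G = xs @ ys \<and> H = xs @ a # ys)"
proof
  assume "ins_code (code_bits G) (code_bits H)"
  then obtain p x y where *: "2 ^ p \<le> Suc x" "Suc x < 2 * 2 ^ p" "code_bits G = x + 2 ^ p * y"
    and H: "code_bits H = x + 2 ^ p * (2 * y + 1) \<or> code_bits H = x + 2 ^ p * (2 * y + 2)"
    unfolding ins_code_def by blast
  obtain xs ys where xs: "x = code_bits xs" and ys: "y = code_bits ys"
    using bij_code_bits by (metis bij_pointE)
  \<comment> \<open>The size conditions on \<open>x\<close> force \<open>p\<close> to be the length
    of the prefix coded by \<open>x\<close>.\<close>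
  have p: "p = length xs"
    using length_unique[of p x "length xs"] * code_bits_bounds[of xs] unfolding xs by blast
  obtain a where "code_bits H = x + 2 ^ p * code_bits (a # ys)"
    using H ys by (metis (full_types) code_bits.simps(2))
  then have "code_bits H = code_bits (xs @ a # ys)" "code_bits G = code_bits (xs @ ys)"
    using * by (simp_all only: xs ys p code_bits_append)
  then show "\<exists>xs ys a. G = xs @ ys \<and> H = xs @ a # ys"
    using bij_code_bits by (metis bij_is_inj injD)
next
  assume "\<exists>xs ys a. G = xs @ ys \<and> H = xs @ a # ys"
  then obtain xs ys a where G: "G = xs @ ys" and H: "H = xs @ a # ys" by blast
  let ?x = "code_bits xs" and ?y = "code_bits ys" and ?p = "length xs"
  have u: "code_bits G = ?x + 2 ^ ?p * ?y" by (simp add: G code_bits_append)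
  \<comment> \<open>The quantifiers of \<open>ins_code\<close> are bounded by \<open>u\<close>, so
    the witnesses, including the length, must not exceed the code.\<close>
  have "?p < 2 ^ ?p" by (rule less_exp)
  then have "?p \<le> code_bits G" using code_bits_bounds[of xs] u by linarith
  moreover have "?x \<le> code_bits G" using u by simp
  moreover have "?y \<le> code_bits G" using u by (simp add: trans_le_add2)
  moreover have v: "code_bits H = ?x + 2 ^ ?p * (2 * ?y + 1) \<or> code_bits H = ?x + 2 ^ ?p * (2 * ?y + 2)"
    by (simp add: H code_bits_append)
  ultimately show "ins_code (code_bits G) (code_bits H)"
    unfolding ins_code_def using u v code_bits_bounds[of xs] by blast
qed

text \<open>The new symbol adds at most \<open>2 * 2 ^ p\<close>, and
  \<open>2 ^ p \<le> Suc x\<close>. This confines all codes reachable in \<open>j\<close> steps to a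
  finite range.\<close>

lemma near_bound: "near u v \<Longrightarrow> Suc v \<le> 4 * Suc u"
  unfolding near_def ins_code_def
proof (elim disjE)
  assume "\<exists>p\<le>u. \<exists>x\<le>u. \<exists>y\<le>u. 2 ^ p \<le> Suc x \<and> Suc x < 2 * 2 ^ p \<and> u = x + 2 ^ p * y \<and>
     (v = x + 2 ^ p * (2 * y + 1) \<or> v = x + 2 ^ p * (2 * y + 2))"
  then show ?thesis by (auto simp: algebra_simps)
next
  assume "\<exists>p\<le>v. \<exists>x\<le>v. \<exists>y\<le>v. 2 ^ p \<le> Suc x \<and> Suc x < 2 * 2 ^ p \<and> v = x + 2 ^ p * y \<and>
     (u = x + 2 ^ p * (2 * y + 1) \<or> u = x + 2 ^ p * (2 * y + 2))"
  then show ?thesis by (auto simp: algebra_simps)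
qed simp

lemma near_relpow_bound: "(near ^^ j) u v \<Longrightarrow> v < 4 ^ j * Suc u"
proof (induction j arbitrary: v)
  case (Suc j)
  then obtain w where "(near ^^ j) u w" "near w v" by auto
  then have "Suc v \<le> 4 * Suc w" "Suc w \<le> 4 ^ j * Suc u"
    using near_bound Suc.IH by (auto simp: Suc_le_eq)
  then have "Suc v \<le> 4 * (4 ^ j * Suc u)"
    by (meson mult_le_mono2 order_trans)
  then show ?case by simp
qed simp

lemma near_sym: "near u v \<Longrightarrow> near v u"
  by (auto simp: near_def)

lemma near_relpow_sym: "(near ^^ j) u v \<Longrightarrow> (near ^^ j) v u"
proof (induction j arbitrary: v)
  case (Suc j)
  then obtain w where "(near ^^ j) u w" "near w v" by auto
  then show ?case using Suc.IH near_sym relpowp_Suc_I2 by metis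
qed simp

lemma near_relpow_refl: "(near ^^ j) u u"
  by (induction j) (auto simp: near_def)

lemma near_relpow_mono:
  assumes "(near ^^ i) u v" "i \<le> j"
  shows "(near ^^ j) u v"
proof -
  have "(near ^^ (i + (j - i))) u v"
    unfolding relpowp_add using assms(1) near_relpow_refl by (rule relcomppI)
  with assms(2) show ?thesis by simp
qed

text \<open>A substitution is a deletion followed by an insertion; the other edits are padded by a
  reflexive step.\<close>

lemma edit_step_near: "edit_step F G \<Longrightarrow> (near ^^ 2) (code_bits F) (code_bits G)"
proof (induction rule: edit_step.induct)
  case (insertion xs ys a)
  have "near (code_bits (xs @ ys)) (code_bits (xs @ a # ys))"
    unfolding near_def ins_code_code_bits by blast
  then show ?case using near_relpow_mono[of 1 _ _ 2] by (simp add: relcompp_apply)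
next
  case (deletion xs a ys)
  have "near (code_bits (xs @ a # ys)) (code_bits (xs @ ys))"
    unfolding near_def ins_code_code_bits by blast
  then show ?case using near_relpow_mono[of 1 _ _ 2] by (simp add: relcompp_apply)
next
  case (substitution xs a ys b)
  have "near (code_bits (xs @ a # ys)) (code_bits (xs @ ys))"
    "near (code_bits (xs @ ys)) (code_bits (xs @ b # ys))"
    unfolding near_def ins_code_code_bits by blast+
  then show ?case by (auto simp: numeral_2_eq_2)
qed

lemma ED_near:
  assumes "ED F G \<le> k"
  shows "(near ^^ (2 * k)) (code_bits F) (code_bits G)"
proof -
  have "(edit_step ^^ m) F G \<Longrightarrow> (near ^^ (2 * m)) (code_bits F) (code_bits G)" for m
  proof (induction m arbitrary: G)
    case (Suc m)
    then obtain H where "(edit_step ^^ m) F H" "edit_step H G" by auto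
    then have "(near ^^ (2 * m + 2)) (code_bits F) (code_bits G)"
      unfolding relpowp_add using Suc.IH edit_step_near by blast
    then show ?case by simp
  qed simp
  from near_relpow_mono[OF this[OF ED_attained]] assms show ?thesis by simp
qed

text \<open>Transfers the counting bound for alignments to the relation used in the search.\<close>

lemma near_relpow_indel:
  "(near ^^ j) (code_bits F) (code_bits G) \<Longrightarrow> indel j F G"
proof (induction j arbitrary: G)
  case 0
  then show ?case using bij_code_bits indel_refl by (metis bij_is_inj injD relpowp_0_E)
next
  case (Suc j)
  then obtain u where "(near ^^ j) (code_bits F) u" "near u (code_bits G)" by auto
  moreover obtain H where "u = code_bits H"
    using bij_code_bits by (metis bij_pointE)
  ultimately have H: "indel j F H" "near (code_bits H) (code_bits G)" using Suc.IH by auto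
  from H(2) consider "H = G" | "\<exists>xs ys a. H = xs @ ys \<and> G = xs @ a # ys"
    | "\<exists>xs ys a. G = xs @ ys \<and> H = xs @ a # ys"
    unfolding near_def ins_code_code_bits using bij_code_bits by (metis bij_is_inj injD)
  then show ?case
    using H(1) by cases (auto intro: indel_insertion indel_deletion indel_Suc)
qed

section \<open>Deciding bounded insertion-deletion distance\<close>

lemma bit_sum_of_bool:
  "odd ((\<Sum>i<n. of_bool (P i) * 2 ^ i) div 2 ^ j :: nat) \<longleftrightarrow> j < n \<and> P j"
proof -
  have "(\<Sum>i<n. of_bool (P i) * 2 ^ i :: nat) = horner_sum of_bool 2 (map P [0..<n])"
    by (simp add: horner_sum_eq_sum atLeast0LessThan)
  then show ?thesis
    by (auto simp: bit_horner_sum_bit_iff simp flip: bit_iff_odd)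
qed

lemma decidable_near:
  assumes "computable f" "computable g"
  shows "decidable (\<lambda>e. near (f e) (g e))"
proof -
  have "decidable (\<lambda>e. ins_code (e 0) (e 1))"
    unfolding ins_code_def by (intro computable_intros)
  from decidable_subst2[OF this]
  have "computable f \<Longrightarrow> computable g \<Longrightarrow> decidable (\<lambda>e. ins_code (f e) (g e))" for f g .
  with assms show ?thesis
    unfolding near_def by (intro decidable_disj decidable_eq)
qed

text \<open>A finite set of codes is represented by the number whose binary digits are its
  characteristic function.\<close>

definition near_set :: "nat \<Rightarrow> nat \<Rightarrow> nat \<Rightarrow> nat" where
  "near_set b u j = rec_nat (2 ^ u)
     (\<lambda>_ A. \<Sum>v<b. of_bool (\<exists>w<b. odd (A div 2 ^ w) \<and> near w v) * 2 ^ v) j"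

text \<open>The bound \<open>b\<close> exceeds every code reachable from \<open>u\<close> in at most
  \<open>j\<close> steps, so truncating each round at \<open>b\<close> loses nothing.\<close>

lemma near_set_iff:
  assumes "i \<le> j" "b = 4 ^ j * Suc u"
  shows "odd (near_set b u i div 2 ^ v) \<longleftrightarrow> (near ^^ i) u v"
  using assms(1)
proof (induction i arbitrary: v)
  case 0
  have "odd ((2 :: nat) ^ u div 2 ^ v) \<longleftrightarrow> u = v"
    by (metis bit_exp_iff bit_iff_odd possible_bit_nat)
  then show ?case by (simp add: near_set_def)
next
  case (Suc i)
  have bound: "w < b" if "(near ^^ l) u w" "l \<le> j" for l w
    using near_relpow_bound[OF near_relpow_mono[OF that]] assms(2) by simp
  have rec: "near_set b u (Suc i) =
      (\<Sum>v<b. of_bool (\<exists>w<b. odd (near_set b u i div 2 ^ w) \<and> near w v) * 2 ^ v)"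
    by (simp add: near_set_def)
  have "odd (near_set b u (Suc i) div 2 ^ v) \<longleftrightarrow>
      v < b \<and> (\<exists>w<b. odd (near_set b u i div 2 ^ w) \<and> near w v)"
    unfolding rec bit_sum_of_bool ..
  also have "\<dots> \<longleftrightarrow> (near ^^ Suc i) u v"
    using Suc bound[of i] bound[of "Suc i" v] by auto
  finally show ?case .
qed

lemma computable_near_set: "computable (\<lambda>e. near_set (e 0) (e 1) (e 2))"
  unfolding near_set_def odd_iff_mod_2_eq_one
  by (intro computable_rec_nat computable_intros computable_of_bool decidable_near)

lemma decidable_near_relpow:
  assumes "computable j" "computable u" "computable v"
  shows "decidable (\<lambda>e. (near ^^ j e) (u e) (v e))"
proof -
  have "(near ^^ j) u v \<longleftrightarrow> near_set (4 ^ j * Suc u) u j div 2 ^ v mod 2 = 1" for j u v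
    using near_set_iff[of j j "4 ^ j * Suc u" u v] by (simp add: odd_iff_mod_2_eq_one)
  then show ?thesis
    using assms by (simp only:) (intro computable_intros computable_subst3[OF computable_near_set])
qed

section \<open>Summaries\<close>

text \<open>The length of the string coded by \<open>u\<close>, as \<open>Suc u\<close> has one more
  binary digit.\<close>

definition bit_length :: "nat \<Rightarrow> nat" where
  "bit_length u = (LEAST n. Suc u < 2 * 2 ^ n)"

lemma computable_bit_length: "computable f \<Longrightarrow> computable (\<lambda>e. bit_length (f e))"
proof (rule computable_subst1[where f = bit_length])
  have "\<exists>n. Suc u < 2 * 2 ^ n" for u
    using less_exp[of "Suc u"] by (intro exI[of _ "Suc u"]) linarith
  then show "computable (\<lambda>e. bit_length (e 0))"
    unfolding bit_length_def by (intro computable_Least computable_intros)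
qed

lemma bit_length_eqI:
  assumes "2 ^ n \<le> Suc u" "Suc u < 2 * 2 ^ n"
  shows "bit_length u = n"
  unfolding bit_length_def
proof (rule Least_equality)
  fix i assume "Suc u < 2 * 2 ^ i"
  with assms have "(2 :: nat) ^ n < 2 ^ Suc i" by simp
  then show "n \<le> i" using power_less_imp_less_exp[of "2 :: nat" n "Suc i"] by simp
qed (rule assms)

lemma bit_length_code_bits: "bit_length (code_bits F) = length F"
  using code_bits_bounds by (intro bit_length_eqI) auto

text \<open>The disjunct \<open>k = 0\<close> only makes the search total.\<close>

definition scale :: "nat \<Rightarrow> nat \<Rightarrow> nat" where
  "scale k n = (LEAST l. 1 \<le> l \<and> (k = 0 \<or> n \<le> k * 2 ^ l))"

lemma ex_scale:
  fixes k n :: nat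
  shows "\<exists>l. 1 \<le> l \<and> (k = 0 \<or> n \<le> k * 2 ^ l)"
proof -
  have "n \<le> k * 2 ^ Suc n" if "k \<noteq> 0"
  proof -
    have "n \<le> 1 * 2 ^ Suc n" using less_exp[of n] unfolding power_Suc by linarith
    also have "\<dots> \<le> k * 2 ^ Suc n" using that by (intro mult_right_mono) auto
    finally show ?thesis .
  qed
  then show ?thesis by (intro exI[of _ "Suc n"]) auto
qed

lemma computable_scale: "computable f \<Longrightarrow> computable g \<Longrightarrow> computable (\<lambda>e. scale (f e) (g e))"
  by (rule computable_subst2[where f = scale])
    (unfold scale_def, intro computable_Least computable_intros ex_scale)

text \<open>The third bound is minimality: the scale is the logarithm of \<open>n / k\<close>
  rounded up, but at least 1.\<close>

lemma scale_bounds: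
  assumes "k > 0"
  shows "1 \<le> scale k n" "n \<le> k * 2 ^ scale k n" "scale k n = 1 \<or> k * 2 ^ (scale k n - 1) < n"
proof -
  let ?P = "\<lambda>l. 1 \<le> l \<and> (k = 0 \<or> n \<le> k * 2 ^ l)"
  have "?P (scale k n)"
    unfolding scale_def by (rule LeastI_ex[OF ex_scale])
  then show *: "1 \<le> scale k n" "n \<le> k * 2 ^ scale k n"
    using assms by auto
  have "\<not> ?P (scale k n - 1)"
    using not_less_Least[of "scale k n - 1" ?P] *(1) unfolding scale_def[symmetric] by simp
  then show "scale k n = 1 \<or> k * 2 ^ (scale k n - 1) < n"
    using * assms by auto
qed

text \<open>The constant 20 leaves room for the exponents in the counting estimates; the square
  gives the growth of \<open>size_bound\<close>.\<close>

definition width :: "nat \<Rightarrow> nat \<Rightarrow> nat" where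
  "width k n = 20 * k * scale k n ^ 2"

text \<open>The scale lies between \<open>?M\<close> and \<open>2 * ?M\<close>; squaring turns this
  factor 2 into the 4 of \<open>80 = 20 * 4\<close>.\<close>

lemma size_bound_le_width:
  assumes "k > 0"
  shows "20 * size_bound n k \<le> real (width k n)" "real (width k n) \<le> 80 * size_bound n k"
proof -
  let ?l = "real (scale k n)" and ?M = "max 1 (log 2 (real n / real k))"
  note l = scale_bounds[OF assms, of n]
  have "log 2 (real n / real k) \<le> ?l"
  \<comment> \<open>For \<open>n = 0\<close> the logarithm of 0 takes its default value 0.\<close>
  proof (cases "n = 0")
    case False
    have "real n \<le> real k * 2 ^ scale k n"
      using of_nat_mono[OF l(2), where 'a = real] by simp
    then have "real n / real k \<le> 2 powr ?l"
      using assms by (simp add: field_simps powr_realpow)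
    then show ?thesis using False assms by (simp add: log_le_iff)
  qed (simp add: log_def)
  then have "?M \<le> ?l" using l(1) by simp
  then have "?M ^ 2 \<le> ?l ^ 2" by (intro power_mono) auto
  then show "20 * size_bound n k \<le> real (width k n)"
    using assms by (simp add: size_bound_def width_def)
  have "?l \<le> 2 * ?M"
    using l(3)
  proof
    assume *: "k * 2 ^ (scale k n - 1) < n"
    have "real (k * 2 ^ (scale k n - 1)) < real n"
      using * by (simp only: of_nat_less_iff)
    then have "2 ^ (scale k n - 1) < real n / real k"
      using assms by (simp add: field_simps)
    then have "real (scale k n - 1) < log 2 (real n / real k)"
      using * assms by (simp add: less_log_iff powr_realpow)
    then show ?thesis using l(1) by auto
  qed simp
  then have "?l ^ 2 \<le> (2 * ?M) ^ 2" by (intro power_mono) auto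
  then have "?l ^ 2 \<le> 4 * ?M ^ 2" by (simp add: power_mult_distrib)
  then have "20 * real k * ?l ^ 2 \<le> 20 * real k * (4 * ?M ^ 2)"
    by (intro mult_left_mono) auto
  then show "real (width k n) \<le> 80 * size_bound n k"
    by (simp add: size_bound_def width_def)
qed

text \<open>The weight \<open>X = 8 * 2 ^ l\<close> is at least 16 as \<open>l \<ge> 1\<close>, and
  at least \<open>8 * n / k\<close>. Hence \<open>(1 + 5 / X) ^ n \<le> exp k \<le> 4 ^ k\<close>,
  while \<open>X ^ (4 * k)\<close> is a power of two with exponent \<open>O(k l)\<close>.\<close>

lemma card_indel_ball_le_width:
  assumes "k > 0"
  shows "card (indel_ball (4 * k) F) \<le> 2 ^ width k (length F)"
proof -
  define n where "n = length F"
  define l where "l = scale k n"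
  define X :: real where "X = 8 * 2 ^ l"
  note l = scale_bounds[OF assms, of n, folded l_def]
  have "(2 :: real) ^ 1 \<le> 2 ^ l" using l(1) by (intro power_increasing) auto
  then have X: "X \<ge> 16" by (simp add: X_def)
  have "(1 + 5 / X) ^ n \<le> exp (5 / X) ^ n"
    using X by (intro power_mono exp_ge_add_one_self) auto
  also have "\<dots> = exp (real n * (5 / X))"
    by (simp only: exp_of_nat_mult)
  also have "\<dots> \<le> exp (real k * 1)"
  proof -
    have "real n \<le> real k * 2 ^ l"
      using of_nat_mono[OF l(2), where 'a = real] by simp
    also have "\<dots> = real k * X / 8" by (simp add: X_def)
    finally have "5 * real n \<le> real k * X * (5 / 8)" by linarith
    also have "\<dots> \<le> real k * X * 1" using X by (intro mult_left_mono) auto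
    finally show ?thesis using X by (simp add: field_simps)
  qed
  also have "\<dots> = exp 1 ^ k" by (simp only: exp_of_nat_mult)
  also have "\<dots> \<le> 4 ^ k"
    using exp_le by (intro power_mono) auto
  also have "(4 :: real) ^ k = 2 ^ (2 * k)" by (simp add: power_mult)
  finally have e: "(1 + 5 / X) ^ n \<le> 2 ^ (2 * k)" .
  have "X = 2 ^ (l + 3)" by (simp add: X_def power_add)
  then have "X ^ (4 * k) = 2 ^ ((l + 3) * (4 * k))"
    by (simp only: power_mult)
  then have "X ^ (4 * k) * (1 + 5 / X) ^ n \<le> 2 ^ ((l + 3) * (4 * k)) * 2 ^ (2 * k)"
    using e by (simp only:) (intro mult_left_mono; simp)
  also have "\<dots> = 2 ^ ((l + 3) * (4 * k) + 2 * k)" by (simp only: power_add)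
  also have "\<dots> \<le> (2 :: real) ^ width k n"
  proof (rule power_increasing)
    \<comment> \<open>As \<open>l \<ge> 1\<close>, the exponent \<open>4 * (k * l) + 14 * k\<close>
      is at most \<open>18 * k * l ^ 2\<close>.\<close>
    have "k * l \<le> k * l ^ 2" "k * 1 \<le> k * l ^ 2"
      using l(1) by (intro mult_le_mono; simp add: power2_eq_square)+
    moreover have "(l + 3) * (4 * k) + 2 * k = 4 * (k * l) + 14 * k" by (simp add: algebra_simps)
    ultimately show "(l + 3) * (4 * k) + 2 * k \<le> width k n"
      unfolding width_def l_def[symmetric] mult.assoc[of 20] by linarith
  qed simp
  finally have "real (card (indel_ball (4 * k) F)) \<le> 2 ^ width k n"
    using card_indel_ball[OF X, of "4 * k" F] unfolding n_def by linarith
  then show ?thesis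
    unfolding n_def by (metis of_nat_le_iff of_nat_numeral of_nat_power)
qed

section \<open>Separating moduli\<close>

definition isolating :: "nat \<Rightarrow> nat \<Rightarrow> nat \<Rightarrow> bool" where
  "isolating k u m \<longleftrightarrow>
     0 < m \<and> (\<forall>v<4 ^ (4 * k) * Suc u. (near ^^ (4 * k)) u v \<and> v mod m = u mod m \<longrightarrow> v = u)"

definition modulus :: "nat \<Rightarrow> nat \<Rightarrow> nat" where
  "modulus k u = (LEAST m. isolating k u m)"

text \<open>A modulus above all candidates leaves their codes unreduced; hence the search for a
  modulus always halts.\<close>

lemma isolating_large: "isolating k u (4 ^ (4 * k) * Suc u)"
proof -
  have "u < 4 ^ (4 * k) * Suc u"
    using near_relpow_bound[OF near_relpow_refl] by blast
  then show ?thesis unfolding isolating_def by auto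
qed

lemma isolating_modulus: "isolating k u (modulus k u)"
  unfolding modulus_def using isolating_large by (rule LeastI)

lemma computable_modulus: "computable f \<Longrightarrow> computable g \<Longrightarrow> computable (\<lambda>e. modulus (f e) (g e))"
proof (rule computable_subst2[where f = modulus])
  show "computable (\<lambda>e. modulus (e 0) (e 1))"
    unfolding modulus_def
  proof (intro computable_Least)
    show "\<exists>m. isolating (e 0) (e 1) m" for e :: "nat \<Rightarrow> nat"
      using isolating_large by blast
  qed (unfold isolating_def, intro computable_intros decidable_near_relpow)
qed

lemma modulus_less:
  assumes "k > 0"
  shows "modulus k (code_bits F) < 2 ^ (3 * width k (length F))"
proof -
  define n where "n = length F"
  define b where "b = width k n"
  define l where "l = scale k n"
  note l = scale_bounds[OF assms, of n, folded l_def]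
  \<comment> \<open>The absolute difference: with truncated subtraction, at least one summand is
    0.\<close>
  define dist where "dist G = (code_bits G - code_bits F) + (code_bits F - code_bits G)" for G
  define A where "A = dist ` (indel_ball (4 * k) F - {F})"
  \<comment> \<open>Strings in the ball have length at most \<open>n + 4 * k\<close>, so their codes
    lie below \<open>2 ^ w\<close>.\<close>
  define w where "w = n + 4 * k + 1"
  have fin: "finite A" unfolding A_def using finite_indel by auto
  have "0 < d \<and> d \<le> 2 ^ w" if "d \<in> A" for d
  proof -
    from that obtain G where G: "indel (4 * k) F G" "G \<noteq> F" and d: "d = dist G"
      unfolding A_def by auto
    have "code_bits G \<noteq> code_bits F"
      using G(2) bij_code_bits by (metis bij_is_inj injD)
    moreover have "code_bits H < 2 ^ w" if "length H \<le> n + 4 * k" for H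
    proof -
      have "code_bits H < 2 ^ Suc (length H)" using code_bits_bounds[of H] by simp
      also have "\<dots> \<le> 2 ^ w" using that by (intro power_increasing) (auto simp: w_def)
      finally show ?thesis .
    qed
    from this[of F] this[of G] have "code_bits F < 2 ^ w" "code_bits G < 2 ^ w"
      using indel_length[OF G(1)] by (auto simp: n_def)
    ultimately show ?thesis unfolding d dist_def by auto
  qed
  from small_nondivisor[OF fin this] obtain m where
    m: "0 < m" "m \<le> w * card A + 2" "\<And>d. d \<in> A \<Longrightarrow> \<not> m dvd d" by blast
  have "isolating k (code_bits F) m"
    unfolding isolating_def
  proof (intro conjI allI impI m)
    fix v assume v: "(near ^^ (4 * k)) (code_bits F) v \<and> v mod m = code_bits F mod m"
    obtain G where G: "v = code_bits G" using bij_code_bits by (metis bij_pointE)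
    show "v = code_bits F"
    proof (rule ccontr)
      assume "v \<noteq> code_bits F"
      then have "dist G \<in> A"
        using v near_relpow_indel unfolding A_def G by auto
      moreover have "m dvd dist G"
      proof (cases "code_bits F \<le> code_bits G")
        case True
        then show ?thesis using v unfolding dist_def G by (simp add: mod_eq_dvd_iff_nat)
      next
        case False
        then show ?thesis
          using v mod_eq_dvd_iff_nat[of "code_bits G" "code_bits F" m] unfolding dist_def G by simp
      qed
      ultimately show False using m(3) by blast
    qed
  qed
  then have "modulus k (code_bits F) \<le> m" unfolding modulus_def by (rule Least_le)
  also have "\<dots> \<le> w * card A + 2" by (rule m)
  also have "card A \<le> 2 ^ b"
  proof -
    have "card A \<le> card (indel_ball (4 * k) F - {F})"
      unfolding A_def using finite_indel by (intro card_image_le) auto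
    also have "\<dots> \<le> card (indel_ball (4 * k) F)"
      by (rule card_Diff1_le)
    finally show ?thesis using card_indel_ball_le_width[OF assms, of F] by (simp add: b_def n_def)
  qed
  \<comment> \<open>Both \<open>n \<le> k * 2 ^ l\<close> and \<open>k < 2 ^ k\<close> enter:
    \<open>w\<close> is at most \<open>2 ^ (3 + (k + l))\<close>, and the exponent is below the
    width.\<close>
  also have "w \<le> 2 ^ b"
  proof -
    have k: "k + 1 \<le> 2 ^ k" using less_exp[of k] by linarith
    have "n \<le> 2 ^ k * 2 ^ l"
      using l(2) less_exp[of k] by (meson less_imp_le mult_le_mono1 order_trans)
    moreover have "2 ^ k * 1 \<le> 2 ^ k * (2 ^ l :: nat)" by (intro mult_le_mono) auto
    ultimately have "w \<le> 8 * (2 ^ k * 2 ^ l)" using k unfolding w_def by linarith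
    also have "\<dots> = 2 ^ (3 + (k + l))" by (simp add: power_add)
    also have "\<dots> \<le> 2 ^ b"
    proof (rule power_increasing)
      have "1 * l \<le> k * l ^ 2" "k * 1 \<le> k * l ^ 2"
        using l(1) assms by (intro mult_le_mono; simp add: power2_eq_square)+
      then show "3 + (k + l) \<le> b"
        using l(1) unfolding b_def width_def l_def[symmetric] mult.assoc[of 20] by linarith
    qed simp
    finally show ?thesis .
  qed
  \<comment> \<open>The third factor \<open>2 ^ b\<close>, at least 2, absorbs the summand
    2.\<close>
  also have "2 ^ b * 2 ^ b + 2 < (2 :: nat) ^ (3 * b)"
  proof -
    have "1 \<le> b"
      using l(1) assms unfolding b_def width_def l_def[symmetric] by (simp add: Suc_le_eq)
    then have "(2 :: nat) ^ 1 \<le> 2 ^ b" by (intro power_increasing) auto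
    then have B: "(2 :: nat) \<le> 2 ^ b" by simp
    have "2 * 2 \<le> (2 :: nat) ^ b * 2 ^ b" using B by (intro mult_le_mono)
    then have "2 ^ b * 2 ^ b + 2 < 2 * ((2 :: nat) ^ b * 2 ^ b)" by linarith
    also have "\<dots> \<le> 2 ^ b * (2 ^ b * 2 ^ b)" using B by (intro mult_le_mono1)
    also have "\<dots> = 2 ^ (3 * b)" by (simp add: power_add[symmetric])
    finally show ?thesis .
  qed
  finally show ?thesis unfolding b_def n_def by simp
qed

section \<open>Encoding and decoding the summary\<close>

text \<open>With \<open>b\<close> the width, \<open>Suc\<close> of this number is a leading 1
  followed by fields of \<open>b\<close>, \<open>3 * b\<close> and \<open>3 * b\<close> binary
  digits for \<open>k\<close>, the modulus and the residue. So it codes a string of exactly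
  \<open>7 * b\<close> bits.\<close>

definition summary :: "nat \<Rightarrow> nat \<Rightarrow> nat" where
  "summary k u = 2 ^ (7 * width k (bit_length u)) + (k * 2 ^ (6 * width k (bit_length u)) +
     modulus k u * 2 ^ (3 * width k (bit_length u)) + u mod modulus k u) - 1"

lemma computable_summary: "computable (\<lambda>e. summary (e 0) (e 1))"
  unfolding summary_def width_def
  by (intro computable_intros computable_modulus computable_bit_length computable_scale)

text \<open>The field width is read off from the total length, which is seven times as
  large.\<close>

definition summary_width :: "nat \<Rightarrow> nat" where
  "summary_width s = bit_length s div 7"

definition summary_payload :: "nat \<Rightarrow> nat" where
  "summary_payload s = Suc s - 2 ^ (7 * summary_width s)"

definition summary_distance :: "nat \<Rightarrow> nat" where
  "summary_distance s = summary_payload s div 2 ^ (6 * summary_width s)"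

definition summary_modulus :: "nat \<Rightarrow> nat" where
  "summary_modulus s = summary_payload s div 2 ^ (3 * summary_width s) mod 2 ^ (3 * summary_width s)"

definition summary_residue :: "nat \<Rightarrow> nat" where
  "summary_residue s = summary_payload s mod 2 ^ (3 * summary_width s)"

text \<open>The first disjunct only makes the search total.\<close>

definition reconstruct :: "nat \<Rightarrow> nat \<Rightarrow> nat" where
  "reconstruct s u = (LEAST v. 4 ^ (2 * summary_distance s) * Suc u \<le> v \<or>
     (near ^^ (2 * summary_distance s)) u v \<and> v mod summary_modulus s = summary_residue s)"

lemma computable_reconstruct: "computable (\<lambda>e. reconstruct (e 0) (e 1))"
  unfolding reconstruct_def
proof (intro computable_Least)
  show "\<exists>v. 4 ^ (2 * summary_distance (e 0)) * Suc (e 1) \<le> v \<or>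
     (near ^^ (2 * summary_distance (e 0))) (e 1) v \<and>
     v mod summary_modulus (e 0) = summary_residue (e 0)" for e :: "nat \<Rightarrow> nat"
    by blast
qed (unfold summary_distance_def summary_modulus_def summary_residue_def summary_payload_def
    summary_width_def, intro computable_intros decidable_near_relpow computable_bit_length)

lemma summary_correct:
  fixes F :: "bool list" and k :: nat
  assumes "k > 0"
  defines "b \<equiv> width k (length F)" and "s \<equiv> summary k (code_bits F)"
  shows "bit_length s = 7 * b" "summary_distance s = k"
    "summary_modulus s = modulus k (code_bits F)"
    "summary_residue s = code_bits F mod modulus k (code_bits F)"
proof -
  define B :: nat where "B = 2 ^ (3 * b)"
  define m where "m = modulus k (code_bits F)"
  define r where "r = code_bits F mod m"
  define t where "t = k * (B * B) + m * B + r"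
  have B: "B > 0" by (simp add: B_def)
  have BB: "2 ^ (6 * b) = B * B" "2 ^ (7 * b) = 2 ^ b * (B * B)"
    by (simp_all add: B_def power_add[symmetric])
  have "0 < m" using isolating_modulus[of k "code_bits F"] by (simp add: m_def isolating_def)
  then have m: "m < B" "r < B"
    using modulus_less[OF assms(1), of F] mod_less_divisor[of m "code_bits F"]
    unfolding B_def b_def r_def m_def[symmetric] by linarith+
  have "k * 1 \<le> k * scale k (length F) ^ 2"
    using scale_bounds(1)[OF assms(1), of "length F"] by (intro mult_le_mono) auto
  then have "k \<le> b" by (simp add: b_def width_def)
  then have "k < 2 ^ b" using less_exp[of b] by linarith
  \<comment> \<open>The two lower fields together do not overflow into the field of
    \<open>k\<close>.\<close>
  have mB: "m * B + r < B * B"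
  proof -
    have "m * B + r < Suc m * B" using m by simp
    also have "\<dots> \<le> B * B" using m by (intro mult_le_mono1) simp
    finally show ?thesis .
  qed
  have tB: "t < 2 ^ (7 * b)"
  proof -
    have "t < Suc k * (B * B)" using mB by (simp add: t_def)
    also have "\<dots> \<le> 2 ^ b * (B * B)" using \<open>k < 2 ^ b\<close> by (intro mult_le_mono1) simp
    finally show ?thesis by (simp add: BB)
  qed
  have s: "Suc s = 2 ^ (7 * b) + t"
    unfolding s_def summary_def bit_length_code_bits b_def[symmetric] m_def[symmetric]
      r_def[symmetric] BB(1) B_def[symmetric] t_def by simp
  show *: "bit_length s = 7 * b"
    by (rule bit_length_eqI) (use s tB in auto)
  then have w: "summary_width s = b" by (simp add: summary_width_def)
  have p: "summary_payload s = t" by (simp add: summary_payload_def w s)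
  show "summary_distance s = k"
    unfolding summary_distance_def w p BB t_def using mB B
    by (simp add: add.assoc)
  have "t = (k * B + m) * B + r" by (simp add: t_def algebra_simps)
  then have "t div B = k * B + m" "t mod B = r" using m B by simp_all
  then show "summary_modulus s = modulus k (code_bits F)"
    "summary_residue s = code_bits F mod modulus k (code_bits F)"
    unfolding summary_modulus_def summary_residue_def w p B_def[symmetric]
    using m by (simp_all add: m_def r_def)
qed

lemma reconstruct_summary:
  assumes "k > 0" "ED F G \<le> k"
  shows "reconstruct (summary k (code_bits F)) (code_bits G) = code_bits F"
proof -
  define u where "u = code_bits F"
  define m where "m = modulus k u"
  define v where "v = reconstruct (summary k u) (code_bits G)"
  let ?P = "\<lambda>v. 4 ^ (2 * k) * Suc (code_bits G) \<le> v \<or>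
     (near ^^ (2 * k)) (code_bits G) v \<and> v mod m = u mod m"
  have v: "v = (LEAST v. ?P v)"
    unfolding v_def reconstruct_def u_def m_def summary_correct[OF assms(1)] ..
  have FG: "(near ^^ (2 * k)) u (code_bits G)"
    using ED_near[OF assms(2)] by (simp add: u_def)
  then have GF: "(near ^^ (2 * k)) (code_bits G) u" by (rule near_relpow_sym)
  then have "?P u" by simp
  \<comment> \<open>The least solution is at most \<open>u\<close>, which lies below the stopping
    bound, so \<open>v\<close> satisfies the genuine second disjunct.\<close>
  then have "?P v" "v \<le> u" unfolding v by (rule LeastI, rule Least_le)
  with near_relpow_bound[OF GF] have Gv: "(near ^^ (2 * k)) (code_bits G) v" "v mod m = u mod m"
    by auto
  \<comment> \<open>Passing through the code of \<open>G\<close> places \<open>v\<close> in the ball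
    in which the modulus isolates \<open>u\<close>.\<close>
  have "(near ^^ (2 * k + 2 * k)) u v"
    unfolding relpowp_add using FG Gv(1) by blast
  then have "(near ^^ (4 * k)) u v" by simp
  with isolating_modulus[of k u] Gv(2) near_relpow_bound[of "4 * k" u v] show ?thesis
    unfolding isolating_def m_def[symmetric] v_def[symmetric] u_def[symmetric] by blast
qed

theorem theorem2:
  "\<exists>(summarize :: program) (recover :: program) (c\<^sub>1 :: real) (c\<^sub>2 :: real).
     c\<^sub>1 > 0 \<and> c\<^sub>2 > 0 \<and>
     (\<forall>(k :: nat) (n :: nat) (F :: bool list). k > 0 \<longrightarrow> length F = n \<longrightarrow>
        (\<exists>S\<^sub>F :: bool list.
           computes summarize [k, code_bits F] (code_bits S\<^sub>F) \<and>
           c\<^sub>1 * size_bound n k \<le> real (length S\<^sub>F) \<and>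
           real (length S\<^sub>F) \<le> c\<^sub>2 * size_bound n k \<and>
           (\<forall>F' :: bool list. ED F F' \<le> k \<longrightarrow>
              computes recover [code_bits S\<^sub>F, code_bits F'] (code_bits F))))"
proof -
  obtain p where p: "\<And>x y. computes p [x, y] (summary x y)"
    using computes_binary[OF computable_summary] by blast
  obtain q where q: "\<And>x y. computes q [x, y] (reconstruct x y)"
    using computes_binary[OF computable_reconstruct] by blast
  show ?thesis
  \<comment> \<open>The summary has seven widths of bits: \<open>140 = 7 * 20\<close> and
    \<open>560 = 7 * 80\<close>.\<close>
  proof (rule exI[of _ p], rule exI[of _ q], rule exI[of _ 140], rule exI[of _ 560],
      intro conjI allI impI)
    fix k n :: nat and F :: "bool list"
    assume k: "k > 0" and n: "length F = n"
    obtain S where S: "summary k (code_bits F) = code_bits S"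
      using bij_code_bits by (metis bij_pointE)
    have len: "length S = 7 * width k n"
      using summary_correct(1)[OF k, of F] by (simp add: S bit_length_code_bits n)
    show "\<exists>S\<^sub>F. computes p [k, code_bits F] (code_bits S\<^sub>F) \<and>
        140 * size_bound n k \<le> real (length S\<^sub>F) \<and>
        real (length S\<^sub>F) \<le> 560 * size_bound n k \<and>
        (\<forall>F'. ED F F' \<le> k \<longrightarrow> computes q [code_bits S\<^sub>F, code_bits F'] (code_bits F))"
    proof (intro exI[of _ S] conjI allI impI)
      show "computes p [k, code_bits F] (code_bits S)"
        using p[of k "code_bits F"] by (simp add: S)
      show "140 * size_bound n k \<le> real (length S)" "real (length S) \<le> 560 * size_bound n k"
        using size_bound_le_width[OF k, of n] by (simp_all add: len)
      show "computes q [code_bits S, code_bits F'] (code_bits F)" if "ED F F' \<le> k" for F'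
        using q[of "code_bits S" "code_bits F'"] reconstruct_summary[OF k that] by (simp add: S)
    qed
  qed simp_all
qed

end
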